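(* Let $G$ be a simply connected nilpotent Lie group with Lie algebra $\mathfrak g$, let $\Gamma\subset G$ be a discrete co-compact subgroup, and let $J$ be an abelian invariant complex structure on $M=\Gamma\backslash G$, with holomorphic tangent sheaf $\Theta_M$. A parameter $\mu\in H^1(M,\Theta_M)$ (represented by an element of $\mathfrak g^{*(0,1)}\otimes\mathfrak g^{1,0}$) defines an integrable infinitesimal abelian deformation if and only if $\bar\partial\mu=0$ and $$\{\mu,\bar\omega\}=0\qquad\text{for every }\bar\omega\in\mathfrak g^{*(0,1)}.$$
   Context: A complex structure $J$ on a Lie algebra $\mathfrak g$ is abelian if $[JA,JB]=[A,B]$ for all $A,B\in\mathfrak g$; equivalently $d\mathfrak g^{*(1,0)}\subset\mathfrak g^{*(1,1)}$. Invariant means induced by a left-invariant structure on $G$. Here $\mathfrak g\otimes\mathbb C=\mathfrak g^{1,0}\oplus\mathfrak g^{0,1}$ is the type decomposition with respect to $J$ and $\mathfrak g^{*(p,q)}$ is the space of invariant $(p,q)$-forms. The operator $\bar\partial$ is defined on $\mathfrak g^{1,0}$ by $(\bar\partial V)(\bar U)=[\bar U,V]^{1,0}$ for $\bar U\in\mathfrak g^{0,1}$, and on $\mathfrak g^{*(0,k)}\otimes\mathfrak g^{1,0}$ by $\bar\partial(\bar\omega\otimes V)=(-1)^k\bar\omega\wedge\bar\partial V$. An invariant Hermitian metric on $M$ is fixed, and classes in $H^1(M,\Theta_M)$ are represented by harmonic elements $\mu\in\mathfrak g^{*(0,1)}\otimes\mathfrak g^{1,0}$, i.e. elements of the orthogonal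 complement of $\bar\partial(\mathfrak g^{1,0})$ in $\ker\bar\partial\subset\mathfrak g^{*(0,1)}\otimes\mathfrak g^{1,0}$. The (extended Schouten-Nijenhuis) bracket is $\{\bar\eta\otimes V,\bar\omega\}=\bar\eta\wedge\iota_Vd\bar\omega$ for $\bar\eta,\bar\omega\in\mathfrak g^{*(0,1)}$ and $V\in\mathfrak g^{1,0}$, extended linearly. For small $\Phi\in\mathfrak g^{*(0,1)}\otimes\mathfrak g^{1,0}$, viewed as a map $\mathfrak g^{0,1}\to\mathfrak g^{1,0}$, let $J_\Phi$ be the invariant almost complex structure whose $(0,1)$-vectors are $\bar X+\Phi(\bar X)$, $\bar X\in\mathfrak g^{0,1}$. One says that $\mu$ defines an integrable infinitesimal abelian deformation if there is a power series $\Phi(t)=t\mu+t^2\phi_2+t^3\phi_3+\cdots$ with $\phi_r\in\mathfrak g^{*(0,1)}\otimes\mathfrak g^{1,0}$, convergent for small $t\in\mathbb C$, such that $J_{\Phi(t)}$ is an (integrable) abelian complex structure for all sufficiently small $t$. *)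

theory Defs
  imports "HOL-Analysis.Analysis" "HOL-Algebra.Generated_Groups"
begin

section \<open>Lie groups\<close>

primrec Ck_on :: "nat \<Rightarrow> 'a::real_normed_vector set \<Rightarrow> ('a \<Rightarrow> 'b::real_normed_vector) \<Rightarrow> bool" where
  "Ck_on 0 S f \<longleftrightarrow> continuous_on S f"
| "Ck_on (Suc k) S f \<longleftrightarrow>
     (\<forall>x\<in>S. f differentiable (at x)) \<and> (\<forall>v. Ck_on k S (\<lambda>x. frechet_derivative f (at x) v))"

text \<open>Intended for open \<open>S\<close> only.\<close>

definition smooth_on :: "'a::real_normed_vector set \<Rightarrow> ('a \<Rightarrow> 'b::real_normed_vector) \<Rightarrow> bool" where
  "smooth_on S f \<longleftrightarrow> (\<forall>k. Ck_on k S f)"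

text \<open>A chart is a pair \<open>(U, \<phi>)\<close>; only the restriction of \<open>\<phi>\<close> to \<open>U\<close> matters.\<close>

definition smooth_atlas :: "('g::topological_space set \<times> ('g \<Rightarrow> 'a::euclidean_space)) set \<Rightarrow> bool" where
  "smooth_atlas \<A> \<longleftrightarrow>
     (\<Union>(U, \<phi>)\<in>\<A>. U) = UNIV \<and>
     (\<forall>(U, \<phi>)\<in>\<A>. open U \<and> open (\<phi> ` U) \<and> homeomorphism U (\<phi> ` U) \<phi> (inv_into U \<phi>)) \<and>
     (\<forall>(U, \<phi>)\<in>\<A>. \<forall>(V, \<psi>)\<in>\<A>. smooth_on (\<phi> ` (U \<inter> V)) (\<psi> \<circ> inv_into U \<phi>))"

definition lie_group ::
  "('g::{t2_space, second_countable_topology}, 'm) monoid_scheme \<Rightarrow>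
   ('g set \<times> ('g \<Rightarrow> 'a::euclidean_space)) set \<Rightarrow> bool" where
  "lie_group G \<A> \<longleftrightarrow>
     group G \<and> carrier G = UNIV \<and> smooth_atlas \<A> \<and>
     continuous_on UNIV (\<lambda>(x, y). x \<otimes>\<^bsub>G\<^esub> y) \<and>
     continuous_on UNIV (\<lambda>x. inv\<^bsub>G\<^esub> x) \<and>
     (\<forall>(U, \<phi>)\<in>\<A>. \<forall>(V, \<psi>)\<in>\<A>. \<forall>(W, \<theta>)\<in>\<A>.
        smooth_on {(a, b). a \<in> \<phi> ` U \<and> b \<in> \<psi> ` V \<and> inv_into U \<phi> a \<otimes>\<^bsub>G\<^esub> inv_into V \<psi> b \<in> W}
          (\<lambda>(a, b). \<theta> (inv_into U \<phi> a \<otimes>\<^bsub>G\<^esub> inv_into V \<psi> b))) \<and>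
     (\<forall>(U, \<phi>)\<in>\<A>. \<forall>(V, \<psi>)\<in>\<A>.
        smooth_on {a. a \<in> \<phi> ` U \<and> inv\<^bsub>G\<^esub> (inv_into U \<phi> a) \<in> V}
          (\<lambda>a. \<psi> (inv\<^bsub>G\<^esub> (inv_into U \<phi> a))))"

text \<open>
  A chart \<open>(U, \<phi>)\<close> around the identity identifies the tangent space at the identity with the
  model space \<open>'a\<close>. Under this identification \<open>left_field G U \<phi> X\<close> is the coordinate
  expression (near \<open>\<phi> \<one>\<close>) of the left-invariant vector field with value \<open>X\<close> at the identity,
  and the Lie algebra of \<open>G\<close> is \<open>'a\<close> with the Lie bracket of left-invariant vector fields.
  Left-invariant tensor fields on \<open>G\<close>, such as an invariant complex structure or Hermitian metric
  on a quotient of \<open>G\<close> by a discrete subgroup, are given by their values at the identity, that is,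
  by tensors on \<open>'a\<close>.
\<close>

definition left_field ::
  "('g, 'm) monoid_scheme \<Rightarrow> 'g set \<Rightarrow> ('g \<Rightarrow> 'a::euclidean_space) \<Rightarrow> 'a \<Rightarrow> 'a \<Rightarrow> 'a" where
  "left_field G U \<phi> X a =
     frechet_derivative (\<lambda>b. \<phi> (inv_into U \<phi> a \<otimes>\<^bsub>G\<^esub> inv_into U \<phi> b)) (at (\<phi> \<one>\<^bsub>G\<^esub>)) X"

definition vector_field_bracket :: "('a \<Rightarrow> 'a) \<Rightarrow> ('a \<Rightarrow> 'a) \<Rightarrow> 'a::real_normed_vector \<Rightarrow> 'a" where
  "vector_field_bracket V W p =
     frechet_derivative W (at p) (V p) - frechet_derivative V (at p) (W p)"

definition lie_bracket ::
  "('g, 'm) monoid_scheme \<Rightarrow> 'g set \<Rightarrow> ('g \<Rightarrow> 'a::euclidean_space) \<Rightarrow> 'a \<Rightarrow> 'a \<Rightarrow> 'a" where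
  "lie_bracket G U \<phi> X Y =
     vector_field_bracket (left_field G U \<phi> X) (left_field G U \<phi> Y) (\<phi> \<one>\<^bsub>G\<^esub>)"

primrec lower_central :: "('g, 'm) monoid_scheme \<Rightarrow> nat \<Rightarrow> 'g set" where
  "lower_central G 0 = carrier G"
| "lower_central G (Suc n) =
     generate G (\<Union>x\<in>lower_central G n. \<Union>y\<in>carrier G. {x \<otimes>\<^bsub>G\<^esub> y \<otimes>\<^bsub>G\<^esub> inv\<^bsub>G\<^esub> x \<otimes>\<^bsub>G\<^esub> inv\<^bsub>G\<^esub> y})"

definition nilpotent_group :: "('g, 'm) monoid_scheme \<Rightarrow> bool" where
  "nilpotent_group G \<longleftrightarrow> group G \<and> (\<exists>n. lower_central G n = {\<one>\<^bsub>G\<^esub>})"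

text \<open>The points of the quotient are the cosets \<open>\<Gamma>g\<close>, with the quotient topology.\<close>

definition cocompact :: "('g::topological_space, 'm) monoid_scheme \<Rightarrow> 'g set \<Rightarrow> bool" where
  "cocompact G \<Gamma> \<longleftrightarrow>
     (\<exists>T. quotient_map (euclidean :: 'g topology) T (\<lambda>g. \<Gamma> #>\<^bsub>G\<^esub> g) \<and> compact_space T)"


section \<open>Complex structures on a Lie algebra\<close>

text \<open>Throughout, \<open>br\<close> is the bracket of a Lie algebra structure on the space \<open>'a\<close>.\<close>

definition almost_complex_structure :: "('a::real_vector \<Rightarrow> 'a) \<Rightarrow> bool" where
  "almost_complex_structure J \<longleftrightarrow> linear J \<and> (\<forall>X. J (J X) = - X)"

definition complex_structure :: "('a \<Rightarrow> 'a \<Rightarrow> 'a) \<Rightarrow> ('a::real_vector \<Rightarrow> 'a) \<Rightarrow> bool" where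
  "complex_structure br J \<longleftrightarrow> almost_complex_structure J \<and>
     (\<forall>X Y. br (J X) (J Y) - J (br (J X) Y) - J (br X (J Y)) - br X Y = 0)"

definition abelian_complex_structure :: "('a \<Rightarrow> 'a \<Rightarrow> 'a) \<Rightarrow> ('a::real_vector \<Rightarrow> 'a) \<Rightarrow> bool" where
  "abelian_complex_structure br J \<longleftrightarrow> complex_structure br J \<and> (\<forall>A B. br (J A) (J B) = br A B)"


section \<open>The complexified Lie algebra\<close>

text \<open>The pair \<open>(x, y)\<close> stands for \<open>x + \<i> y\<close>.\<close>

type_synonym 'a cx = "'a \<times> 'a"

definition cscale :: "complex \<Rightarrow> 'a::real_vector cx \<Rightarrow> 'a cx" where
  "cscale c Z = (Re c *\<^sub>R fst Z - Im c *\<^sub>R snd Z, Re c *\<^sub>R snd Z + Im c *\<^sub>R fst Z)"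

lemma vector_space_cscale: "vector_space (cscale :: complex \<Rightarrow> 'a::real_vector cx \<Rightarrow> 'a cx)"
  by unfold_locales (auto simp: cscale_def prod_eq_iff algebra_simps)

definition cbr :: "('a \<Rightarrow> 'a \<Rightarrow> 'a) \<Rightarrow> 'a::real_vector cx \<Rightarrow> 'a cx \<Rightarrow> 'a cx" where
  "cbr br Z W = (br (fst Z) (fst W) - br (snd Z) (snd W), br (fst Z) (snd W) + br (snd Z) (fst W))"

definition cJ :: "('a \<Rightarrow> 'a) \<Rightarrow> 'a cx \<Rightarrow> 'a cx" where
  "cJ J Z = (J (fst Z), J (snd Z))"

definition g10 :: "('a \<Rightarrow> 'a) \<Rightarrow> 'a::real_vector cx set" where
  "g10 J = {Z. cJ J Z = cscale \<i> Z}"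

definition g01 :: "('a \<Rightarrow> 'a) \<Rightarrow> 'a::real_vector cx set" where
  "g01 J = {Z. cJ J Z = cscale (- \<i>) Z}"

definition proj10 :: "('a \<Rightarrow> 'a) \<Rightarrow> 'a::real_vector cx \<Rightarrow> 'a cx" where
  "proj10 J Z = cscale (1/2) (Z - cscale \<i> (cJ J Z))"

definition proj01 :: "('a \<Rightarrow> 'a) \<Rightarrow> 'a::real_vector cx \<Rightarrow> 'a cx" where
  "proj01 J Z = cscale (1/2) (Z + cscale \<i> (cJ J Z))"


section \<open>Forms\<close>

text \<open>
  Invariant \<open>k\<close>-forms are complex multilinear functions on the complexified Lie algebra. A form
  of type \<open>(0,k)\<close>, possibly with values in \<open>g10 J\<close>, vanishes as soon as one argument is in
  \<open>g10 J\<close>; in particular a tensor in \<open>tensor01 J\<close> is the same as a complex linear map from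
  \<open>g01 J\<close> to \<open>g10 J\<close>.
\<close>

definition form01 :: "('a \<Rightarrow> 'a) \<Rightarrow> ('a::real_vector cx \<Rightarrow> complex) set" where
  "form01 J = {\<omega>. Vector_Spaces.linear cscale (*) \<omega> \<and> (\<forall>Z\<in>g10 J. \<omega> Z = 0)}"

definition tensor01 :: "('a \<Rightarrow> 'a) \<Rightarrow> ('a::real_vector cx \<Rightarrow> 'a cx) set" where
  "tensor01 J = {\<Phi>. Vector_Spaces.linear cscale cscale \<Phi> \<and>
                    (\<forall>Z\<in>g10 J. \<Phi> Z = 0) \<and> range \<Phi> \<subseteq> g10 J}"

definition tens :: "('a cx \<Rightarrow> complex) \<Rightarrow> 'a::real_vector cx \<Rightarrow> 'a cx \<Rightarrow> 'a cx" where
  "tens \<eta> V = (\<lambda>Z. cscale (\<eta> Z) V)"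

definition wedge ::
  "('a cx \<Rightarrow> complex) \<Rightarrow> ('a cx \<Rightarrow> complex) \<Rightarrow> 'a cx \<Rightarrow> 'a cx \<Rightarrow> complex" where
  "wedge \<alpha> \<beta> A B = \<alpha> A * \<beta> B - \<alpha> B * \<beta> A"

definition wedge_vec ::
  "('a cx \<Rightarrow> complex) \<Rightarrow> ('a cx \<Rightarrow> 'a::real_vector cx) \<Rightarrow> 'a cx \<Rightarrow> 'a cx \<Rightarrow> 'a cx" where
  "wedge_vec \<alpha> \<Psi> A B = cscale (\<alpha> A) (\<Psi> B) - cscale (\<alpha> B) (\<Psi> A)"

definition ext_d :: "('a \<Rightarrow> 'a \<Rightarrow> 'a) \<Rightarrow> ('a::real_vector cx \<Rightarrow> complex) \<Rightarrow> 'a cx \<Rightarrow> 'a cx \<Rightarrow> complex" where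
  "ext_d br \<omega> A B = - \<omega> (cbr br A B)"

definition contract :: "'v \<Rightarrow> ('v \<Rightarrow> 'v \<Rightarrow> complex) \<Rightarrow> 'v \<Rightarrow> complex" where
  "contract V \<theta> = (\<lambda>B. \<theta> V B)"

definition dbar0 :: "('a \<Rightarrow> 'a \<Rightarrow> 'a) \<Rightarrow> ('a \<Rightarrow> 'a) \<Rightarrow> 'a::real_vector cx \<Rightarrow> 'a cx \<Rightarrow> 'a cx" where
  "dbar0 br J V = (\<lambda>Z. proj10 J (cbr br (proj01 J Z) V))"

text \<open>
  The vectors \<open>(b, 0)\<close> with \<open>b \<in> Basis\<close> form a complex basis of the complexification, and
  \<open>dual01 J b\<close> is the \<open>(0,1)\<close>-part of the corresponding dual basis covector. Every tensor is the
  sum of the decomposable tensors \<open>dual01 J b \<otimes> \<Phi> (b, 0)\<close> (see \<open>tensor01_expansion\<close> below).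
  This is used to extend operations linearly from decomposable tensors to all tensors.
\<close>

definition dual01 :: "('a \<Rightarrow> 'a) \<Rightarrow> 'a::euclidean_space \<Rightarrow> 'a cx \<Rightarrow> complex" where
  "dual01 J b Z = Complex (fst (proj01 J Z) \<bullet> b) (snd (proj01 J Z) \<bullet> b)"

text \<open>On a decomposable tensor \<open>\<eta> \<otimes> V\<close> this is \<open>- \<eta> \<and> dbar0 V\<close> (see \<open>dbar1_tens\<close>).\<close>

definition dbar1 ::
  "('a \<Rightarrow> 'a \<Rightarrow> 'a) \<Rightarrow> ('a \<Rightarrow> 'a) \<Rightarrow> ('a::euclidean_space cx \<Rightarrow> 'a cx) \<Rightarrow> 'a cx \<Rightarrow> 'a cx \<Rightarrow> 'a cx" where
  "dbar1 br J \<Phi> A B = (\<Sum>b\<in>Basis. - wedge_vec (dual01 J b) (dbar0 br J (\<Phi> (b, 0))) A B)"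

text \<open>On a decomposable tensor \<open>\<eta> \<otimes> V\<close> this is \<open>\<eta> \<and> \<iota>\<^sub>V d\<omega>\<close> (see \<open>sn_bracket_tens\<close>).\<close>

definition sn_bracket ::
  "('a \<Rightarrow> 'a \<Rightarrow> 'a) \<Rightarrow> ('a \<Rightarrow> 'a) \<Rightarrow> ('a::euclidean_space cx \<Rightarrow> 'a cx) \<Rightarrow>
   ('a cx \<Rightarrow> complex) \<Rightarrow> 'a cx \<Rightarrow> 'a cx \<Rightarrow> complex" where
  "sn_bracket br J \<Phi> \<omega> A B =
     (\<Sum>b\<in>Basis. wedge (dual01 J b) (contract (\<Phi> (b, 0)) (ext_d br \<omega>)) A B)"


section \<open>Invariant Hermitian metrics and harmonic representatives\<close>

definition hermitian_metric :: "('a \<Rightarrow> 'a) \<Rightarrow> ('a::real_vector \<Rightarrow> 'a \<Rightarrow> real) \<Rightarrow> bool" where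
  "hermitian_metric J h \<longleftrightarrow>
     (\<forall>X. linear (h X)) \<and> (\<forall>X Y. h X Y = h Y X) \<and> (\<forall>X. X \<noteq> 0 \<longrightarrow> h X X > 0) \<and>
     (\<forall>X Y. h (J X) (J Y) = h X Y)"

text \<open>Sesquilinear extension to the complexification, linear in the first argument.\<close>

definition herm :: "('a \<Rightarrow> 'a \<Rightarrow> real) \<Rightarrow> 'a cx \<Rightarrow> 'a cx \<Rightarrow> complex" where
  "herm h Z W = Complex (h (fst Z) (fst W) + h (snd Z) (snd W)) (h (snd Z) (fst W) - h (fst Z) (snd W))"

definition sharp :: "('a \<Rightarrow> 'a \<Rightarrow> real) \<Rightarrow> ('a cx \<Rightarrow> complex) \<Rightarrow> 'a cx" where
  "sharp h \<omega> = (THE W. \<forall>Z. \<omega> Z = herm h Z W)"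

definition form_inner :: "('a \<Rightarrow> 'a \<Rightarrow> real) \<Rightarrow> ('a cx \<Rightarrow> complex) \<Rightarrow> ('a cx \<Rightarrow> complex) \<Rightarrow> complex" where
  "form_inner h \<eta> \<omega> = herm h (sharp h \<omega>) (sharp h \<eta>)"

text \<open>
  The sesquilinear extension of
  \<open>\<langle>\<eta> \<otimes> V, \<omega> \<otimes> W\<rangle> = form_inner h \<eta> \<omega> * herm h V W\<close> (see \<open>tensor_inner_tens\<close>).
\<close>

definition tensor_inner ::
  "('a \<Rightarrow> 'a) \<Rightarrow> ('a \<Rightarrow> 'a \<Rightarrow> real) \<Rightarrow>
   ('a::euclidean_space cx \<Rightarrow> 'a cx) \<Rightarrow> ('a cx \<Rightarrow> 'a cx) \<Rightarrow> complex" where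
  "tensor_inner J h \<Phi> \<Psi> =
     (\<Sum>a\<in>Basis. \<Sum>b\<in>Basis. form_inner h (dual01 J a) (dual01 J b) * herm h (\<Phi> (a, 0)) (\<Psi> (b, 0)))"

text \<open>
  \<open>\<mu>\<close> lies in the orthogonal complement of the image of \<open>dbar0\<close> in the kernel of \<open>dbar1\<close>. These
  \<open>\<mu>\<close> are the representatives of the classes in the first cohomology of the holomorphic tangent
  sheaf of the quotient of \<open>G\<close> by a lattice.
\<close>

definition harmonic ::
  "('a \<Rightarrow> 'a \<Rightarrow> 'a) \<Rightarrow> ('a \<Rightarrow> 'a) \<Rightarrow> ('a \<Rightarrow> 'a \<Rightarrow> real) \<Rightarrow> ('a::euclidean_space cx \<Rightarrow> 'a cx) \<Rightarrow> bool" where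
  "harmonic br J h \<mu> \<longleftrightarrow> \<mu> \<in> tensor01 J \<and> (\<forall>A B. dbar1 br J \<mu> A B = 0) \<and>
     (\<forall>V\<in>g10 J. tensor_inner J h \<mu> (dbar0 br J V) = 0)"


section \<open>Deformations\<close>

text \<open>\<open>J'\<close> is the structure \<open>J\<^sub>\<Phi>\<close>; an almost complex structure is determined by its \<open>(0,1)\<close>-vectors.\<close>

definition deformed_structure ::
  "('a \<Rightarrow> 'a) \<Rightarrow> ('a::real_vector cx \<Rightarrow> 'a cx) \<Rightarrow> ('a \<Rightarrow> 'a) \<Rightarrow> bool" where
  "deformed_structure J \<Phi> J' \<longleftrightarrow>
     almost_complex_structure J' \<and> g01 J' = (\<lambda>Z. Z + \<Phi> Z) ` g01 J"

definition integrable_abelian_deformation ::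
  "('a \<Rightarrow> 'a \<Rightarrow> 'a) \<Rightarrow> ('a \<Rightarrow> 'a) \<Rightarrow> ('a::euclidean_space cx \<Rightarrow> 'a cx) \<Rightarrow> bool" where
  "integrable_abelian_deformation br J \<mu> \<longleftrightarrow>
     (\<exists>(\<phi> :: nat \<Rightarrow> 'a cx \<Rightarrow> 'a cx) (\<Phi> :: complex \<Rightarrow> 'a cx \<Rightarrow> 'a cx).
        (\<forall>r. \<phi> r \<in> tensor01 J) \<and> \<phi> 0 = (\<lambda>_. 0) \<and> \<phi> 1 = \<mu> \<and>
        (\<forall>\<^sub>F t in nhds 0.
           (\<forall>Z. (\<lambda>r. cscale (t ^ r) (\<phi> r Z)) sums \<Phi> t Z) \<and>
           (\<exists>J'. deformed_structure J (\<Phi> t) J' \<and> abelian_complex_structure br J')))"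


section \<open>The operations on decomposable tensors\<close>

lemma linear_cscale_iff:
  "Vector_Spaces.linear (cscale :: complex \<Rightarrow> 'a::real_vector cx \<Rightarrow> 'a cx) (*) \<omega> \<longleftrightarrow>
     (\<forall>Z W. \<omega> (Z + W) = \<omega> Z + \<omega> W) \<and> (\<forall>c Z. \<omega> (cscale c Z) = c * \<omega> Z)"
  unfolding Vector_Spaces.linear_iff_module_hom module_hom_iff
  by (simp add: module_iff_vector_space vector_space_cscale vector_space_over_itself.vector_space_axioms)

lemma linear_cscale2_iff:
  "Vector_Spaces.linear (cscale :: complex \<Rightarrow> 'a::real_vector cx \<Rightarrow> 'a cx) cscale \<Phi> \<longleftrightarrow>
     (\<forall>Z W. \<Phi> (Z + W) = \<Phi> Z + \<Phi> W) \<and> (\<forall>c Z. \<Phi> (cscale c Z) = cscale c (\<Phi> Z))"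
  unfolding Vector_Spaces.linear_iff_module_hom module_hom_iff
  by (simp add: module_iff_vector_space vector_space_cscale)

lemma additive_sum:
  fixes f :: "'b::ab_group_add \<Rightarrow> 'c::ab_group_add"
  assumes "\<And>x y. f (x + y) = f x + f y"
  shows "f (sum g S) = (\<Sum>x\<in>S. f (g x))"
proof -
  interpret additive f by standard (rule assms)
  show ?thesis by (rule sum)
qed

context
  fixes J :: "'a::euclidean_space \<Rightarrow> 'a"
  assumes acs: "almost_complex_structure J"
begin

lemma J_lin: "J (x + y) = J x + J y" "J (x - y) = J x - J y" "J (c *\<^sub>R x) = c *\<^sub>R J x"
  "J (- x) = - J x" "J (J x) = - x"
  using acs by (auto simp: almost_complex_structure_def linear_add linear_diff linear_scale linear_neg)

lemma proj_sum: "proj10 J Z + proj01 J Z = Z"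
  by (simp add: proj10_def proj01_def cscale_def cJ_def prod_eq_iff scaleR_right_distrib
      scaleR_right_diff_distrib flip: scaleR_add_left)

lemma proj10_mem: "proj10 J Z \<in> g10 J"
  by (simp add: proj10_def g10_def cscale_def cJ_def prod_eq_iff J_lin scaleR_right_distrib
      scaleR_right_diff_distrib)

lemma proj01_mem: "proj01 J Z \<in> g01 J"
  by (simp add: proj01_def g01_def cscale_def cJ_def prod_eq_iff J_lin scaleR_right_distrib
      scaleR_right_diff_distrib)

lemma proj01_g10: "Z \<in> g10 J \<Longrightarrow> proj01 J Z = 0"
  by (auto simp: g10_def proj01_def cscale_def prod_eq_iff)

lemma proj01_linear:
  "proj01 J (Z + W) = proj01 J Z + proj01 J W"
  "proj01 J (cscale c Z) = cscale c (proj01 J Z)"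
  by (auto simp: proj01_def cscale_def cJ_def prod_eq_iff J_lin algebra_simps)

lemma dual01_mem: "dual01 J b \<in> form01 J"
proof -
  have "dual01 J b (Z + W) = dual01 J b Z + dual01 J b W" for Z W
    by (simp add: dual01_def proj01_linear complex_eq_iff inner_simps)
  moreover have "dual01 J b (cscale c Z) = c * dual01 J b Z" for c Z
    unfolding dual01_def proj01_linear
    by (simp add: complex_eq_iff cscale_def inner_simps)
  moreover have "dual01 J b Z = 0" if "Z \<in> g10 J" for Z
    by (simp add: dual01_def proj01_g10[OF that] complex_eq_iff)
  ultimately show ?thesis
    unfolding form01_def linear_cscale_iff by blast
qed

lemma dual01_sum: "(\<Sum>b\<in>Basis. cscale (dual01 J b Z) (b, 0)) = proj01 J Z"
proof (rule prod_eqI)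
  show "fst (\<Sum>b\<in>Basis. cscale (dual01 J b Z) (b, 0)) = fst (proj01 J Z)"
    by (simp add: fst_sum dual01_def cscale_def euclidean_representation)
  show "snd (\<Sum>b\<in>Basis. cscale (dual01 J b Z) (b, 0)) = snd (proj01 J Z)"
    by (simp add: snd_sum dual01_def cscale_def euclidean_representation)
qed

lemma form01_expansion:
  assumes "\<eta> \<in> form01 J"
  shows "\<eta> Z = (\<Sum>b\<in>Basis. dual01 J b Z * \<eta> (b, 0))"
proof -
  have lin: "\<And>Z W. \<eta> (Z + W) = \<eta> Z + \<eta> W" "\<And>c Z. \<eta> (cscale c Z) = c * \<eta> Z"
    and z: "\<And>Z. Z \<in> g10 J \<Longrightarrow> \<eta> Z = 0"
    using assms by (auto simp: form01_def linear_cscale_iff)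
  have "\<eta> Z = \<eta> (proj01 J Z)"
    using lin(1)[of "proj10 J Z" "proj01 J Z"] z[OF proj10_mem] by (simp add: proj_sum)
  also have "\<dots> = (\<Sum>b\<in>Basis. dual01 J b Z * \<eta> (b, 0))"
    by (simp only: dual01_sum[symmetric] additive_sum[of \<eta>, OF lin(1)] lin(2))
  finally show ?thesis .
qed

lemma tensor01_expansion:
  assumes "\<Phi> \<in> tensor01 J"
  shows "\<Phi> Z = (\<Sum>b\<in>Basis. tens (dual01 J b) (\<Phi> (b, 0)) Z)"
proof -
  have lin: "\<And>Z W. \<Phi> (Z + W) = \<Phi> Z + \<Phi> W" "\<And>c Z. \<Phi> (cscale c Z) = cscale c (\<Phi> Z)"
    and z: "\<And>Z. Z \<in> g10 J \<Longrightarrow> \<Phi> Z = 0"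
    using assms by (auto simp: tensor01_def linear_cscale2_iff)
  have "\<Phi> Z = \<Phi> (proj01 J Z)"
    using lin(1)[of "proj10 J Z" "proj01 J Z"] z[OF proj10_mem] by (simp add: proj_sum)
  also have "\<dots> = (\<Sum>b\<in>Basis. tens (dual01 J b) (\<Phi> (b, 0)) Z)"
    by (simp only: dual01_sum[symmetric] additive_sum[of \<Phi>, OF lin(1)] lin(2) tens_def)
  finally show ?thesis .
qed

lemma tens_mem:
  assumes "\<eta> \<in> form01 J" "V \<in> g10 J"
  shows "tens \<eta> V \<in> tensor01 J"
proof -
  have "cscale c V \<in> g10 J" for c
    using assms(2) by (auto simp: g10_def cJ_def cscale_def prod_eq_iff J_lin)
  then show ?thesis
    using assms(1) unfolding form01_def tensor01_def linear_cscale_iff linear_cscale2_iff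
    by (simp add: tens_def image_subset_iff) (auto simp: cscale_def prod_eq_iff algebra_simps)
qed

lemma cbr_linear_right:
  assumes "bilinear br"
  shows "cbr br Z (V + W) = cbr br Z V + cbr br Z W"
    and "cbr br Z (cscale c V) = cscale c (cbr br Z V)"
  using assms
  by (auto simp: cbr_def cscale_def prod_eq_iff bilinear_radd bilinear_rsub bilinear_rmul algebra_simps)

lemma cbr_linear_left:
  assumes "bilinear br"
  shows "cbr br (cscale c V) Z = cscale c (cbr br V Z)"
  using assms
  by (auto simp: cbr_def cscale_def prod_eq_iff bilinear_ladd bilinear_lsub bilinear_lmul algebra_simps)

lemma dbar0_cscale:
  assumes "bilinear br"
  shows "dbar0 br J (cscale c V) Z = cscale c (dbar0 br J V Z)"
  unfolding dbar0_def cbr_linear_right(2)[OF assms]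
  by (auto simp: proj10_def cscale_def cJ_def prod_eq_iff J_lin algebra_simps)

lemma dbar1_tens:
  assumes "bilinear br" "\<eta> \<in> form01 J"
  shows "dbar1 br J (tens \<eta> V) A B = - wedge_vec \<eta> (dbar0 br J V) A B"
proof -
  have c: "cscale (\<Sum>b\<in>S. f b) W = (\<Sum>b\<in>S. cscale (f b) W)" for S :: "'a set" and f and W :: "'a cx"
    by (rule additive_sum) (simp add: cscale_def algebra_simps)
  have "wedge_vec \<eta> (dbar0 br J V) A B =
      (\<Sum>b\<in>Basis. cscale (dual01 J b A * \<eta> (b, 0)) (dbar0 br J V B)) -
      (\<Sum>b\<in>Basis. cscale (dual01 J b B * \<eta> (b, 0)) (dbar0 br J V A))"
    by (simp only: wedge_vec_def form01_expansion[OF assms(2), of A] form01_expansion[OF assms(2), of B] c)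
  also have "\<dots> = (\<Sum>b\<in>Basis. wedge_vec (dual01 J b) (dbar0 br J (tens \<eta> V (b, 0))) A B)"
    by (simp add: sum_subtractf wedge_vec_def tens_def dbar0_cscale[OF assms(1)]
        vector_space.vector_space_assms(3)[OF vector_space_cscale])
  finally show ?thesis
    by (simp add: dbar1_def sum_negf)
qed

lemma sn_bracket_tens:
  assumes "bilinear br" "\<eta> \<in> form01 J" "\<omega> \<in> form01 J"
  shows "sn_bracket br J (tens \<eta> V) \<omega> A B = wedge \<eta> (contract V (ext_d br \<omega>)) A B"
proof -
  have lin: "\<omega> (cscale c Z) = c * \<omega> Z" for c Z
    using assms(3) unfolding form01_def linear_cscale_iff by blast
  show ?thesis
    unfolding sn_bracket_def wedge_def form01_expansion[OF assms(2), of A] form01_expansion[OF assms(2), of B]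
    by (simp add: tens_def contract_def ext_d_def cbr_linear_left[OF assms(1)] lin
        sum_subtractf sum_distrib_left sum_distrib_right sum_negf ac_simps)
qed

context
  fixes h
  assumes metric: "hermitian_metric J h"
begin

lemma h_lin: "h (x + y) z = h x z + h y z" "h z (x + y) = h z x + h z y"
  "h (x - y) z = h x z - h y z" "h z (x - y) = h z x - h z y"
  "h (c *\<^sub>R x) z = c * h x z" "h z (c *\<^sub>R x) = c * h z x" "h 0 z = 0" "h z 0 = 0"
proof -
  have l: "\<And>z. linear (h z)" and s: "\<And>x y. h x y = h y x"
    using metric by (auto simp: hermitian_metric_def)
  show "h z (x + y) = h z x + h z y" "h z (x - y) = h z x - h z y" "h z (c *\<^sub>R x) = c * h z x" "h z 0 = 0"
    using l[of z] by (auto simp: linear_add linear_diff linear_scale linear_0)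
  then show "h (x + y) z = h x z + h y z" "h (x - y) z = h x z - h y z" "h (c *\<^sub>R x) z = c * h x z" "h 0 z = 0"
    by (auto simp: s[of _ z])
qed

lemma herm_lin:
  "herm h (Z + Z') W = herm h Z W + herm h Z' W" "herm h (cscale c Z) W = c * herm h Z W"
  "herm h W (Z + Z') = herm h W Z + herm h W Z'" "herm h W (Z - Z') = herm h W Z - herm h W Z'"
  "herm h W (cscale c Z) = cnj c * herm h W Z"
  by (auto simp: herm_def cscale_def complex_eq_iff h_lin algebra_simps)

lemma herm_zero:
  assumes "herm h Z Z = 0"
  shows "Z = 0"
proof -
  have "h (fst Z) (fst Z) + h (snd Z) (snd Z) = 0"
    using assms by (simp add: herm_def complex_eq_iff)
  moreover have "x \<noteq> 0 \<Longrightarrow> h x x > 0" for x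
    using metric by (auto simp: hermitian_metric_def)
  moreover have "h x x \<ge> 0" for x
    using calculation(2)[of x] by (cases "x = 0") (auto simp: h_lin)
  ultimately show ?thesis
    by (metis add_pos_nonneg add_nonneg_pos less_irrefl prod_eq_iff fst_zero snd_zero)
qed

lemma sharp_exists:
  assumes "Vector_Spaces.linear cscale (*) \<omega>"
  shows "\<omega> Z = herm h Z (sharp h \<omega>)"
proof -
  have lin: "\<And>Z W. \<omega> (Z + W) = \<omega> Z + \<omega> W" "\<And>c Z. \<omega> (cscale c Z) = c * \<omega> Z"
    using assms by (auto simp: linear_cscale_iff)
  have sc: "r *\<^sub>R Z = cscale (of_real r) Z" for r and Z :: "'a cx"
    by (simp add: cscale_def prod_eq_iff)
  define A where "A W = (\<Sum>b\<in>Basis. Re (herm h b W) *\<^sub>R b)" for W :: "'a cx"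
  have inner_A: "Z \<bullet> A W = Re (herm h Z W)" for Z W
  proof -
    have "Re (herm h (\<Sum>b\<in>Basis. (Z \<bullet> b) *\<^sub>R b) W) = (\<Sum>b\<in>Basis. (Z \<bullet> b) *\<^sub>R Re (herm h b W))"
      by (subst additive_sum[of "\<lambda>Z. Re (herm h Z W)"]) (simp_all add: herm_lin sc)
    then show ?thesis
      by (simp add: A_def inner_sum_right euclidean_representation mult.commute)
  qed
  have "linear A"
  proof (rule linearI)
    show "A (X + Y) = A X + A Y" for X Y
      by (simp add: A_def herm_lin scaleR_left_distrib sum.distrib)
    show "A (r *\<^sub>R X) = r *\<^sub>R A X" for r X
      unfolding sc[of r X] by (simp add: A_def herm_lin scaleR_sum_right)
  qed
  moreover have "inj A"
  proof (rule injI)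
    fix X Y assume "A X = A Y"
    then have "Re (herm h (X - Y) X) = Re (herm h (X - Y) Y)"
      by (metis inner_A)
    then have "Re (herm h (X - Y) (X - Y)) = 0"
      by (simp add: herm_lin)
    moreover have "Im (herm h (X - Y) (X - Y)) = 0"
      using metric by (simp add: herm_def hermitian_metric_def)
    ultimately show "X = Y"
      using herm_zero[of "X - Y"] by (simp add: complex_eq_iff)
  qed
  ultimately have "surj A"
    by (rule linear_injective_imp_surjective) simp
  then obtain W where W: "A W = (\<Sum>b\<in>Basis. Re (\<omega> b) *\<^sub>R b)"
    by (metis surjD)
  have Re: "Re (\<omega> Z) = Re (herm h Z W)" for Z
  proof -
    have "Re (\<omega> (\<Sum>b\<in>Basis. (Z \<bullet> b) *\<^sub>R b)) = (\<Sum>b\<in>Basis. (Z \<bullet> b) *\<^sub>R Re (\<omega> b))"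
      by (subst additive_sum[of "\<lambda>Z. Re (\<omega> Z)"]) (simp_all add: lin sc)
    then have "Re (\<omega> Z) = Z \<bullet> A W"
      by (simp add: W inner_sum_right euclidean_representation mult.commute)
    then show ?thesis by (simp add: inner_A)
  qed
  have ex: "\<omega> Z = herm h Z W" for Z
    using Re[of Z] Re[of "cscale \<i> Z"] by (simp add: lin herm_lin complex_eq_iff)
  have "sharp h \<omega> = W"
    unfolding sharp_def
  proof (rule the_equality)
    fix W' assume "\<forall>Z. \<omega> Z = herm h Z W'"
    then have "herm h (W' - W) W' = herm h (W' - W) W"
      by (metis ex)
    then have "herm h (W' - W) (W' - W) = 0"
      by (simp add: herm_lin)
    then show "W' = W" using herm_zero by fastforce
  qed (simp add: ex)
  then show ?thesis by (simp add: ex)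
qed

lemma sharp_dual01:
  assumes "\<eta> \<in> form01 J"
  shows "sharp h \<eta> = (\<Sum>b\<in>Basis. cscale (cnj (\<eta> (b, 0))) (sharp h (dual01 J b)))"
proof -
  let ?S = "\<Sum>b\<in>Basis. cscale (cnj (\<eta> (b, 0))) (sharp h (dual01 J b))"
  have l: "Vector_Spaces.linear cscale (*) \<eta>" "\<And>b. Vector_Spaces.linear cscale (*) (dual01 J b)"
    using assms dual01_mem by (auto simp: form01_def)
  have "herm h Z ?S = \<eta> Z" for Z
  proof -
    have "herm h Z ?S = (\<Sum>b\<in>Basis. \<eta> (b, 0) * dual01 J b Z)"
      by (simp add: additive_sum[of "herm h Z"] herm_lin flip: sharp_exists[OF l(2)])
    then show ?thesis
      by (simp add: form01_expansion[OF assms, of Z] mult.commute)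
  qed
  then have "herm h (sharp h \<eta> - ?S) (sharp h \<eta> - ?S) = 0"
    by (simp only: herm_lin flip: sharp_exists[OF l(1)]) simp
  then show ?thesis using herm_zero by fastforce
qed

lemma tensor_inner_tens:
  assumes "\<eta> \<in> form01 J" "\<omega> \<in> form01 J"
  shows "tensor_inner J h (tens \<eta> V) (tens \<omega> W) = form_inner h \<eta> \<omega> * herm h V W"
proof -
  have s: "herm h (\<Sum>b\<in>S. f b) Z = (\<Sum>b\<in>S. herm h (f b) Z)"
      "herm h Z (\<Sum>b\<in>S. f b) = (\<Sum>b\<in>S. herm h Z (f b))" for S :: "'a set" and f Z
    using additive_sum[of "\<lambda>X. herm h X Z" f S] additive_sum[of "herm h Z" f S]
    by (auto simp: herm_lin)
  have "form_inner h \<eta> \<omega> = (\<Sum>a\<in>Basis. \<Sum>b\<in>Basis.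
      cnj (\<omega> (b, 0)) * (\<eta> (a, 0) * form_inner h (dual01 J a) (dual01 J b)))"
    unfolding form_inner_def sharp_dual01[OF assms(1)] sharp_dual01[OF assms(2)]
    by (simp add: s herm_lin sum_distrib_left ac_simps)
  then show ?thesis
    by (simp add: tensor_inner_def tens_def herm_lin sum_distrib_left sum_distrib_right ac_simps)
qed

end

end

end

theory Submission
  imports Defs
begin

text \<open>
  A complex structure is abelian iff its \<open>(0,1)\<close>-vectors form an abelian subalgebra. Since \<open>g01 J\<close>
  and \<open>g10 J\<close> are both abelian, the bracket of \<open>Z + \<Phi> Z\<close> and \<open>W + \<Phi> W\<close> reduces to
  \<open>[Z, \<Phi> W] + [\<Phi> Z, W]\<close>, which is linear in \<open>\<Phi>\<close>. Its \<open>(1,0)\<close>-part is \<open>dbar1 \<Phi>\<close>, and pairing its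
  \<open>(0,1)\<close>-part with the \<open>(0,1)\<close>-forms gives \<open>{\<Phi>, \<omega>}\<close>. So the leading coefficient \<open>\<mu>\<close> of an abelian
  deformation satisfies both equations, and conversely they make \<open>t \<mu>\<close> an abelian deformation.
\<close>

section \<open>Bilinearity of the Lie bracket of a Lie group\<close>

text \<open>On the chart, all left-invariant fields are partial derivatives of one function
  \<open>F\<close>, the multiplication in coordinates. One derivative of \<open>F\<close> gives
  linearity in \<open>X\<close>; a second one gives differentiability in the base point, which the
  bracket of vector fields requires.\<close>

lemma left_field_derivative:
  assumes "lie_group G \<A>" and "(U, \<phi>) \<in> \<A>" and "\<one>\<^bsub>G\<^esub> \<in> U"
  obtains F where "\<And>a. a \<in> \<phi> ` U \<Longrightarrow> F differentiable (at (a, \<phi> \<one>\<^bsub>G\<^esub>))"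
    and "\<And>a v. a \<in> \<phi> ` U \<Longrightarrow> (\<lambda>x. frechet_derivative F (at x) v) differentiable (at (a, \<phi> \<one>\<^bsub>G\<^esub>))"
    and "\<And>a X. a \<in> \<phi> ` U \<Longrightarrow>
           left_field G U \<phi> X a = frechet_derivative F (at (a, \<phi> \<one>\<^bsub>G\<^esub>)) (0, X)"
proof -
  define F where "F = (\<lambda>(a, b). \<phi> (inv_into U \<phi> a \<otimes>\<^bsub>G\<^esub> inv_into U \<phi> b))"
  define S where "S = {(a, b). a \<in> \<phi> ` U \<and> b \<in> \<phi> ` U \<and> inv_into U \<phi> a \<otimes>\<^bsub>G\<^esub> inv_into U \<phi> b \<in> U}"
  have grp: "group G" and UNIV: "carrier G = UNIV" and at: "smooth_atlas \<A>"
    using assms(1) by (auto simp: lie_group_def)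
  have "smooth_on S F"
    using assms(1,2) unfolding lie_group_def S_def F_def by fast
  then have C2: "Ck_on (Suc (Suc 0)) S F"
    unfolding smooth_on_def by blast
  have "homeomorphism U (\<phi> ` U) \<phi> (inv_into U \<phi>)"
    using at assms(2) unfolding smooth_atlas_def by blast
  then have inv: "inv_into U \<phi> (\<phi> u) = u" if "u \<in> U" for u
    using that by (auto simp: homeomorphism_def)
  \<comment> \<open>Multiplying by the identity does not leave \<open>U\<close>, so these points lie
    in the domain where \<open>F\<close> is smooth.\<close>
  have S: "(a, \<phi> \<one>\<^bsub>G\<^esub>) \<in> S" if "a \<in> \<phi> ` U" for a
    using that assms(3) by (auto simp: S_def inv UNIV group.is_monoid[OF grp] monoid.r_one)
  have diff: "F differentiable (at (a, \<phi> \<one>\<^bsub>G\<^esub>))" if "a \<in> \<phi> ` U" for a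
    using C2 S[OF that] by simp
  show ?thesis
  proof
    fix a assume a: "a \<in> \<phi> ` U"
    show "F differentiable (at (a, \<phi> \<one>\<^bsub>G\<^esub>))"
      using diff[OF a] .
    show "(\<lambda>x. frechet_derivative F (at x) v) differentiable (at (a, \<phi> \<one>\<^bsub>G\<^esub>))" for v
      using C2 S[OF a] unfolding Ck_on.simps by blast
    fix X
    have F': "(F has_derivative frechet_derivative F (at (a, \<phi> \<one>\<^bsub>G\<^esub>))) (at (a, \<phi> \<one>\<^bsub>G\<^esub>))"
      using diff[OF a] frechet_derivative_works by blast
    have "((\<lambda>b. F (a, b)) has_derivative (\<lambda>v. frechet_derivative F (at (a, \<phi> \<one>\<^bsub>G\<^esub>)) (0, v))) (at (\<phi> \<one>\<^bsub>G\<^esub>))"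
      by (rule has_derivative_compose[where f = "\<lambda>b. (a, b)" and f' = "\<lambda>v. (0, v)" and g = F, OF _ F'])
        (auto intro!: derivative_eq_intros)
    from frechet_derivative_at[OF this]
    show "left_field G U \<phi> X a = frechet_derivative F (at (a, \<phi> \<one>\<^bsub>G\<^esub>)) (0, X)"
      unfolding left_field_def F_def by (auto dest: fun_cong[of _ _ X])
  qed
qed

text \<open>On the open chart image the left-invariant fields depend linearly on \<open>X\<close>,
  hence so do their derivatives at \<open>?p\<close>, and each derivative is linear in its
  direction. Since \<open>frechet_derivative\<close> is a choice, every identity is first proved for
  \<open>has_derivative\<close> and then transferred by uniqueness.\<close>

lemma lie_bracket_bilinear:
  assumes "lie_group G \<A>" and "(U, \<phi>) \<in> \<A>" and "\<one>\<^bsub>G\<^esub> \<in> U"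
  shows "bilinear (lie_bracket G U \<phi>)"
proof -
  let ?p = "\<phi> \<one>\<^bsub>G\<^esub>"
  let ?L = "left_field G U \<phi>"
  let ?D = "\<lambda>X. frechet_derivative (?L X) (at ?p)"
  obtain F where F: "\<And>a. a \<in> \<phi> ` U \<Longrightarrow> F differentiable (at (a, ?p))"
    "\<And>a v. a \<in> \<phi> ` U \<Longrightarrow> (\<lambda>x. frechet_derivative F (at x) v) differentiable (at (a, ?p))"
    "\<And>a X. a \<in> \<phi> ` U \<Longrightarrow> ?L X a = frechet_derivative F (at (a, ?p)) (0, X)"
    using left_field_derivative[OF assms] by blast
  have op: "open (\<phi> ` U)"
    using assms(1,2) unfolding lie_group_def smooth_atlas_def by blast
  have p: "?p \<in> \<phi> ` U"
    using assms(3) by blast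
  have lin: "linear (frechet_derivative F (at (a, ?p)))" if "a \<in> \<phi> ` U" for a
    using F(1)[OF that] by (rule linear_frechet_derivative)
  have add: "?L (X + Y) a = ?L X a + ?L Y a" if "a \<in> \<phi> ` U" for X Y a
    using linear_add[OF lin[OF that], of "(0, X)" "(0, Y)"] by (simp add: F(3)[OF that])
  have scale: "?L (c *\<^sub>R X) a = c *\<^sub>R ?L X a" if "a \<in> \<phi> ` U" for c X a
    using linear_scale[OF lin[OF that], of c "(0, X)"] by (simp add: F(3)[OF that])
  have diff: "(?L X has_derivative ?D X) (at ?p)" for X
  proof -
    \<comment> \<open>Restricting to the first slot turns this second-order derivative of
      \<open>F\<close> into the derivative of \<open>?L X\<close>.\<close>
    obtain F' where "((\<lambda>x. frechet_derivative F (at x) (0, X)) has_derivative F') (at (?p, ?p))"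
      using F(2)[OF p] unfolding differentiable_def by blast
    then have "((\<lambda>a. frechet_derivative F (at (a, ?p)) (0, X)) has_derivative (\<lambda>v. F' (v, 0))) (at ?p)"
      by (rule has_derivative_compose[where f = "\<lambda>a. (a, ?p)", rotated])
        (auto intro!: derivative_eq_intros)
    then have "(?L X has_derivative (\<lambda>v. F' (v, 0))) (at ?p)"
      by (rule has_derivative_transform_within_open[OF _ op p]) (simp add: F(3))
    then show ?thesis
      using differentiableI frechet_derivative_works by blast
  qed
  have D_lin: "linear (?D X)" for X
    using diff has_derivative_linear by blast
  have D_add: "?D (X + Y) v = ?D X v + ?D Y v" for X Y v
  proof -
    have "(?L (X + Y) has_derivative (\<lambda>v. ?D X v + ?D Y v)) (at ?p)"
      by (rule has_derivative_transform_within_open[OF has_derivative_add[OF diff diff] op p])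
        (simp add: add)
    from frechet_derivative_at[OF this] show ?thesis by (rule fun_cong[symmetric])
  qed
  have D_scale: "?D (c *\<^sub>R X) v = c *\<^sub>R ?D X v" for c X v
  proof -
    have "(?L (c *\<^sub>R X) has_derivative (\<lambda>v. c *\<^sub>R ?D X v)) (at ?p)"
      by (rule has_derivative_transform_within_open[OF has_derivative_scaleR_right[OF diff] op p])
        (simp add: scale)
    from frechet_derivative_at[OF this] show ?thesis by (rule fun_cong[symmetric])
  qed
  show ?thesis
    unfolding bilinear_def
    by (intro conjI allI linearI)
      (simp_all add: lie_bracket_def vector_field_bracket_def D_add D_scale add[OF p] scale[OF p]
        linear_add[OF D_lin] linear_scale[OF D_lin] algebra_simps)
qed

lemma lie_bracket_antisym: "lie_bracket G U \<phi> Y X = - lie_bracket G U \<phi> X Y"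
  by (simp add: lie_bracket_def vector_field_bracket_def)


section \<open>Abelian complex structures in terms of vectors of pure type\<close>

lemma g01_iff:
  fixes J :: "'a::euclidean_space \<Rightarrow> 'a"
  assumes "almost_complex_structure J"
  shows "Z \<in> g01 J \<longleftrightarrow> snd Z = J (fst Z)"
  using J_lin[OF assms] by (auto simp: g01_def cJ_def cscale_def prod_eq_iff)

lemma g10_iff:
  fixes J :: "'a::euclidean_space \<Rightarrow> 'a"
  assumes "almost_complex_structure J"
  shows "Z \<in> g10 J \<longleftrightarrow> snd Z = - J (fst Z)"
  using J_lin[OF assms] by (auto simp: g10_def cJ_def cscale_def prod_eq_iff)

text \<open>For \<open>Z = (A, J A)\<close> and \<open>W = (B, J B)\<close> the real and imaginary
  parts of the bracket are \<open>br A B - br (J A) (J B)\<close> and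
  \<open>br A (J B) + br (J A) B\<close>. If the first vanishes identically then so does the second,
  on replacing \<open>B\<close> by \<open>J B\<close>. Conversely, both together make the Nijenhuis
  expression zero, so integrability comes for free.\<close>

lemma abelian_iff_g01:
  fixes J :: "'a::euclidean_space \<Rightarrow> 'a"
  assumes "bilinear br" and acs: "almost_complex_structure J"
  shows "abelian_complex_structure br J \<longleftrightarrow> (\<forall>Z\<in>g01 J. \<forall>W\<in>g01 J. cbr br Z W = 0)"
proof
  assume "abelian_complex_structure br J"
  then have ab: "br (J A) (J B) = br A B" for A B
    by (simp add: abelian_complex_structure_def)
  have "br (J A) B + br A (J B) = 0" for A B
    using ab[of A "J B"] by (simp add: J_lin[OF acs] bilinear_rneg[OF assms(1)] neg_eq_iff_add_eq_0)
  then show "\<forall>Z\<in>g01 J. \<forall>W\<in>g01 J. cbr br Z W = 0"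
    by (auto simp: g01_iff[OF acs] cbr_def ab prod_eq_iff add.commute)
next
  assume *: "\<forall>Z\<in>g01 J. \<forall>W\<in>g01 J. cbr br Z W = 0"
  have 1: "br (J A) (J B) = br A B" and "br (J A) B = - br A (J B)" for A B
    using *[rule_format, of "(A, J A)" "(B, J B)"]
    by (auto simp: g01_iff[OF acs] cbr_def prod_eq_iff eq_neg_iff_add_eq_0 add.commute)
  then show "abelian_complex_structure br J"
    using acs by (simp add: abelian_complex_structure_def complex_structure_def J_lin[OF acs])
qed

lemma abelian_g10:
  fixes J :: "'a::euclidean_space \<Rightarrow> 'a"
  assumes "bilinear br" and "abelian_complex_structure br J" and "Z \<in> g10 J" and "W \<in> g10 J"
  shows "cbr br Z W = 0"
proof -
  have acs: "almost_complex_structure J" and ab: "\<And>A B. br (J A) (J B) = br A B"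
    using assms(2) by (auto simp: abelian_complex_structure_def complex_structure_def)
  have "br (J A) B + br A (J B) = 0" for A B
    using ab[of A "J B"] by (simp add: J_lin[OF acs] bilinear_rneg[OF assms(1)] neg_eq_iff_add_eq_0)
  then have "br (J A) B = - br A (J B)" for A B
    by (simp add: eq_neg_iff_add_eq_0)
  then show ?thesis
    using assms(3,4)
    by (auto simp: g10_iff[OF acs] cbr_def ab J_lin[OF acs] prod_eq_iff bilinear_lneg[OF assms(1)]
        bilinear_rneg[OF assms(1)])
qed

lemma cbr_add:
  assumes "bilinear br"
  shows "cbr br (Z + Z') W = cbr br Z W + cbr br Z' W"
    and "cbr br Z (W + W') = cbr br Z W + cbr br Z W'"
  using assms by (auto simp: cbr_def prod_eq_iff bilinear_radd bilinear_ladd algebra_simps)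

lemma cbr_antisym:
  assumes "\<And>X Y. br Y X = - br X Y"
  shows "cbr br W Z = - cbr br Z W"
  by (simp add: cbr_def prod_eq_iff assms[of "fst Z"] assms[of "snd Z"])

text \<open>These are the cross terms of the bracket of \<open>Z + \<Phi> Z\<close> with
  \<open>W + \<Phi> W\<close>. Their linearity in \<open>\<Phi>\<close> allows a condition on a
  power series to be read off coefficient by coefficient.\<close>

definition deform_bracket ::
  "('a \<Rightarrow> 'a \<Rightarrow> 'a) \<Rightarrow> ('a::real_vector cx \<Rightarrow> 'a cx) \<Rightarrow> 'a cx \<Rightarrow> 'a cx \<Rightarrow> 'a cx" where
  "deform_bracket br \<Phi> Z W = cbr br Z (\<Phi> W) + cbr br (\<Phi> Z) W"

text \<open>The terms of order zero and two in \<open>\<Phi>\<close> are brackets inside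
  \<open>g01 J\<close> and inside \<open>g10 J\<close>, hence zero. Only the values of
  \<open>\<Phi>\<close> are constrained, so the criterion applies directly to the pointwise sum of a
  power series.\<close>

lemma deformed_abelian_iff:
  fixes J :: "'a::euclidean_space \<Rightarrow> 'a"
  assumes bil: "bilinear br" and ab: "abelian_complex_structure br J"
    and \<Phi>: "\<And>Z. \<Phi> Z \<in> g10 J" and J': "deformed_structure J \<Phi> J'"
  shows "abelian_complex_structure br J' \<longleftrightarrow> (\<forall>Z\<in>g01 J. \<forall>W\<in>g01 J. deform_bracket br \<Phi> Z W = 0)"
proof -
  have acs: "almost_complex_structure J"
    using ab by (auto simp: abelian_complex_structure_def complex_structure_def)
  have acs': "almost_complex_structure J'" and im: "g01 J' = (\<lambda>Z. Z + \<Phi> Z) ` g01 J"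
    using J' by (auto simp: deformed_structure_def)
  have "cbr br (Z + \<Phi> Z) (W + \<Phi> W) = deform_bracket br \<Phi> Z W" if "Z \<in> g01 J" "W \<in> g01 J" for Z W
    using that ab abelian_g10[OF bil ab \<Phi> \<Phi>]
    by (simp add: deform_bracket_def cbr_add[OF bil] abelian_iff_g01[OF bil acs] add.commute)
  then show ?thesis
    by (simp add: abelian_iff_g01[OF bil acs'] im)
qed


lemma cscale_zero: "cscale 0 V = 0"
  by (simp add: cscale_def prod_eq_iff)


section \<open>The two equations for the deformation parameter\<close>

lemma additive_minus:
  fixes f :: "'b::ab_group_add \<Rightarrow> 'c::ab_group_add"
  assumes "\<And>x y. f (x + y) = f x + f y"
  shows "f (- x) = - f x"
proof -
  interpret additive f by standard (rule assms)
  show ?thesis by (rule minus)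
qed

lemma proj10_add:
  fixes J :: "'a::euclidean_space \<Rightarrow> 'a"
  assumes "almost_complex_structure J"
  shows "proj10 J (Z + W) = proj10 J Z + proj10 J W"
  by (auto simp: proj10_def cscale_def cJ_def prod_eq_iff J_lin[OF assms] algebra_simps)

lemma proj01_g01:
  fixes J :: "'a::euclidean_space \<Rightarrow> 'a"
  assumes "almost_complex_structure J" and "Z \<in> g01 J"
  shows "proj01 J Z = Z"
proof -
  have "fst (proj01 J Z) = fst Z" "snd (proj01 J Z) = snd Z"
    using assms(2) by (auto simp: proj01_def cJ_def cscale_def g01_iff[OF assms(1)] J_lin[OF assms(1)]
        simp flip: scaleR_add_left scaleR_diff_left)
  then show ?thesis by (rule prod_eqI)
qed

text \<open>The sum over \<open>Basis\<close> reassembles \<open>\<Phi> A\<close> by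
  \<open>tensor01_expansion\<close>, because \<open>dbar0\<close> is complex linear in its vector
  argument. The result is a formula free of the basis.\<close>

lemma dbar1_eq:
  fixes J :: "'a::euclidean_space \<Rightarrow> 'a"
  assumes bil: "bilinear br" and acs: "almost_complex_structure J" and \<Phi>: "\<Phi> \<in> tensor01 J"
  shows "dbar1 br J \<Phi> A B = dbar0 br J (\<Phi> B) A - dbar0 br J (\<Phi> A) B"
proof -
  have "(\<Sum>b\<in>Basis. cscale (dual01 J b A) (dbar0 br J (\<Phi> (b, 0)) B)) = dbar0 br J (\<Phi> A) B" for A B
  proof -
    have add: "dbar0 br J (V + W) B = dbar0 br J V B + dbar0 br J W B" for V W
      by (simp add: dbar0_def cbr_add[OF bil] proj10_add[OF acs])
    show ?thesis
      unfolding tensor01_expansion[OF acs \<Phi>, of A]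
      by (simp add: additive_sum[of "\<lambda>V. dbar0 br J V B", OF add] tens_def dbar0_cscale[OF acs bil])
  qed
  then show ?thesis
    by (simp add: dbar1_def wedge_vec_def sum_subtractf)
qed

text \<open>The same reassembly, now for the complex linear map sending \<open>V\<close> to
  \<open>\<omega> (cbr br V B)\<close>. The order of the two terms reflects the minus sign in
  \<open>ext_d\<close>.\<close>

lemma sn_bracket_eq:
  fixes J :: "'a::euclidean_space \<Rightarrow> 'a"
  assumes bil: "bilinear br" and acs: "almost_complex_structure J" and \<Phi>: "\<Phi> \<in> tensor01 J"
    and \<omega>: "\<omega> \<in> form01 J"
  shows "sn_bracket br J \<Phi> \<omega> A B = \<omega> (cbr br (\<Phi> B) A) - \<omega> (cbr br (\<Phi> A) B)"
proof -
  have lin: "\<And>Z W. \<omega> (Z + W) = \<omega> Z + \<omega> W" "\<And>c Z. \<omega> (cscale c Z) = c * \<omega> Z"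
    using \<omega> unfolding form01_def linear_cscale_iff by blast+
  have "(\<Sum>b\<in>Basis. dual01 J b A * \<omega> (cbr br (\<Phi> (b, 0)) B)) = \<omega> (cbr br (\<Phi> A) B)" for A B
  proof -
    have add: "\<omega> (cbr br (V + W) B) = \<omega> (cbr br V B) + \<omega> (cbr br W B)" for V W
      by (simp add: cbr_add[OF bil] lin)
    show ?thesis
      unfolding tensor01_expansion[OF acs \<Phi>, of A]
      by (simp add: additive_sum[of "\<lambda>V. \<omega> (cbr br V B)", OF add] tens_def cbr_linear_left[OF acs bil] lin)
  qed
  then show ?thesis
    by (simp add: sn_bracket_def wedge_def contract_def ext_d_def sum_subtractf sum_negf)
qed

text \<open>Both operators are components of one vector \<open>?E A B\<close>, so their joint
  vanishing is the vanishing of that vector. Projecting the arguments by \<open>proj01\<close>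
  reconciles \<open>deform_bracket\<close> on \<open>g01 J\<close> with equations stated for all
  complex vectors.\<close>

lemma deform_bracket_zero_iff:
  fixes J :: "'a::euclidean_space \<Rightarrow> 'a"
  assumes bil: "bilinear br" and anti: "\<And>X Y. br Y X = - br X Y"
    and ab: "abelian_complex_structure br J" and \<Phi>: "\<Phi> \<in> tensor01 J"
  shows "(\<forall>Z\<in>g01 J. \<forall>W\<in>g01 J. deform_bracket br \<Phi> Z W = 0) \<longleftrightarrow>
    (\<forall>A B. dbar1 br J \<Phi> A B = 0) \<and> (\<forall>\<omega>\<in>form01 J. \<forall>A B. sn_bracket br J \<Phi> \<omega> A B = 0)"
proof -
  have acs: "almost_complex_structure J"
    using ab by (auto simp: abelian_complex_structure_def complex_structure_def)
  have \<Phi>10: "\<Phi> Z \<in> g10 J" for Z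
    using \<Phi> by (auto simp: tensor01_def)
  have \<Phi>add: "\<Phi> (Z + W) = \<Phi> Z + \<Phi> W" and \<Phi>0: "Z \<in> g10 J \<Longrightarrow> \<Phi> Z = 0" for Z W
    using \<Phi> unfolding tensor01_def linear_cscale2_iff by blast+
  have \<Phi>proj: "\<Phi> (proj01 J Z) = \<Phi> Z" for Z
    using \<Phi>add[of "proj10 J Z" "proj01 J Z"] \<Phi>0[OF proj10_mem[OF acs]] by (simp add: proj_sum[OF acs])
  \<comment> \<open>Values of \<open>\<Phi>\<close> commute with the \<open>(1,0)\<close>-part of
    the other argument, as \<open>g10 J\<close> is abelian.\<close>
  have br_proj: "cbr br (\<Phi> A) (proj01 J B) = cbr br (\<Phi> A) B" for A B
    using cbr_add(2)[OF bil, of "\<Phi> A" "proj10 J B" "proj01 J B"]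
      abelian_g10[OF bil ab \<Phi>10 proj10_mem[OF acs]] by (simp add: proj_sum[OF acs])
  let ?E = "\<lambda>A B. deform_bracket br \<Phi> (proj01 J A) (proj01 J B)"
  have E: "?E A B = cbr br (\<Phi> A) B - cbr br (\<Phi> B) A" for A B
    using cbr_antisym[of br, OF anti, of "\<Phi> B" "proj01 J A"]
    by (simp add: deform_bracket_def \<Phi>proj br_proj)
  have dbar: "dbar1 br J \<Phi> A B = proj10 J (?E A B)" for A B
  proof -
    have m: "proj10 J (- Z) = - proj10 J Z" for Z
      by (rule additive_minus) (rule proj10_add[OF acs])
    have *: "dbar0 br J (\<Phi> A) B = - proj10 J (cbr br (\<Phi> A) B)" for A B
      using cbr_antisym[of br, OF anti, of "proj01 J B" "\<Phi> A"]
      by (simp add: dbar0_def br_proj m)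
    show ?thesis
      using proj10_add[OF acs, of "cbr br (\<Phi> A) B" "- cbr br (\<Phi> B) A"]
      by (simp add: dbar1_eq[OF bil acs \<Phi>] * E m)
  qed
  have sn: "sn_bracket br J \<Phi> \<omega> A B = - \<omega> (?E A B)" if \<omega>: "\<omega> \<in> form01 J" for \<omega> A B
  proof -
    have add: "\<And>Z W. \<omega> (Z + W) = \<omega> Z + \<omega> W"
      using \<omega> unfolding form01_def linear_cscale_iff by blast+
    show ?thesis
      using add[of "cbr br (\<Phi> A) B" "- cbr br (\<Phi> B) A"]
      by (simp add: sn_bracket_eq[OF bil acs \<Phi> \<omega>] E additive_minus[of \<omega>, OF add])
  qed
  have zero: "\<omega> 0 = 0" if "\<omega> \<in> form01 J" for \<omega>
  proof -
    have "\<omega> (0 + 0) = \<omega> 0 + \<omega> 0"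
      using that unfolding form01_def linear_cscale_iff by blast
    then show ?thesis by simp
  qed
  have proj0: "proj10 J 0 = 0"
    using proj10_add[OF acs, of 0 0] by simp
  show ?thesis
  proof
    assume "\<forall>Z\<in>g01 J. \<forall>W\<in>g01 J. deform_bracket br \<Phi> Z W = 0"
    then have "?E A B = 0" for A B
      by (simp add: proj01_mem[OF acs])
    then show "(\<forall>A B. dbar1 br J \<Phi> A B = 0) \<and> (\<forall>\<omega>\<in>form01 J. \<forall>A B. sn_bracket br J \<Phi> \<omega> A B = 0)"
      by (simp add: dbar sn zero proj0)
  next
    assume *: "(\<forall>A B. dbar1 br J \<Phi> A B = 0) \<and> (\<forall>\<omega>\<in>form01 J. \<forall>A B. sn_bracket br J \<Phi> \<omega> A B = 0)"
    have "?E A B = 0" for A B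
    proof -
      \<comment> \<open>The forms \<open>dual01 J b\<close> are the coordinates of the
        \<open>(0,1)\<close>-part, so they suffice to detect it.\<close>
      have "dual01 J b (?E A B) = 0" for b
        using *[THEN conjunct2, rule_format, OF dual01_mem[OF acs], of b A B]
        by (simp add: sn[OF dual01_mem[OF acs]])
      then have "proj01 J (?E A B) = 0"
        by (simp only: cscale_zero sum.neutral_const flip: dual01_sum[OF acs, of "?E A B"])
      moreover have "proj10 J (?E A B) = 0"
        using * dbar[of A B] by metis
      ultimately show ?thesis
        using proj_sum[OF acs, of "?E A B"] by simp
    qed
    then show "\<forall>Z\<in>g01 J. \<forall>W\<in>g01 J. deform_bracket br \<Phi> Z W = 0"
      by (metis proj01_g01[OF acs])
  qed
qed


section \<open>Deformations\<close>

lemma cscale_simps: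
  "fst (cscale c Z) = Re c *\<^sub>R fst Z - Im c *\<^sub>R snd Z"
  "snd (cscale c Z) = Re c *\<^sub>R snd Z + Im c *\<^sub>R fst Z"
  by (simp_all add: cscale_def)

text \<open>
  The complex structure is \<open>P \<circ> J \<circ> P\<inverse>\<close>, where \<open>P\<close> is the restriction to real vectors of the map
  which is \<open>Z \<mapsto> Z + \<Phi> Z\<close> on \<open>g01 J\<close> and commutes with conjugation.
\<close>

lemma deformed_structure_exists:
  fixes J :: "'a::euclidean_space \<Rightarrow> 'a"
  assumes acs: "almost_complex_structure J" and \<Phi>: "\<Phi> \<in> tensor01 J"
    and small: "\<And>x. x \<noteq> 0 \<Longrightarrow> norm (2 *\<^sub>R fst (\<Phi> (x, 0))) < norm x"
  shows "\<exists>J'. deformed_structure J \<Phi> J'"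
proof -
  have \<Phi>lin: "\<Phi> (Z + W) = \<Phi> Z + \<Phi> W" "\<Phi> (cscale c Z) = cscale c (\<Phi> Z)" for Z W c
    using \<Phi> unfolding tensor01_def linear_cscale2_iff by blast+
  have \<Phi>10: "snd (\<Phi> Z) = - J (fst (\<Phi> Z))" for Z
    using \<Phi> by (auto simp: tensor01_def g10_iff[OF acs, symmetric])
  \<comment> \<open>\<open>Q x\<close> is the real part of \<open>\<Phi> (x, J x)\<close>. The
    factor 2 arises because \<open>(x, J x) + (x, - J x)\<close> is twice \<open>(x, 0)\<close> and
    \<open>\<Phi>\<close> kills the second summand.\<close>
  define Q where "Q x = 2 *\<^sub>R fst (\<Phi> (x, 0))" for x
  have linQ: "linear Q"
  proof (rule linearI)
    show "Q (x + y) = Q x + Q y" for x y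
      using \<Phi>lin(1)[of "(x, 0)" "(y, 0)"] by (simp add: Q_def scaleR_add_right)
    show "Q (r *\<^sub>R x) = r *\<^sub>R Q x" for r x
      using \<Phi>lin(2)[of "of_real r" "(x, 0)"] by (simp add: Q_def cscale_def)
  qed
  have Q\<Phi>: "\<Phi> (x, J x) = (Q x, - J (Q x))" for x
  proof -
    have "(x, - J x) \<in> g10 J" by (simp add: g10_iff[OF acs])
    then have "\<Phi> (x, - J x) = 0" using \<Phi> by (auto simp: tensor01_def)
    then have "\<Phi> (x, J x) = \<Phi> (x, J x) + \<Phi> (x, - J x)" by simp
    also have "\<dots> = \<Phi> (cscale 2 (x, 0))"
      by (simp add: cscale_def scaleR_2 flip: \<Phi>lin(1))
    finally have "\<Phi> (x, J x) = cscale 2 (\<Phi> (x, 0))" by (simp only: \<Phi>lin(2))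
    then show ?thesis
      using \<Phi>10[of "(x, J x)"] by (simp add: prod_eq_iff Q_def cscale_def)
  qed
  define P where "P x = x + Q x" for x
  have linP: "linear P"
    unfolding P_def by (intro linear_compose_add linear_id[unfolded id_def] linQ)
  \<comment> \<open>A kernel vector would satisfy \<open>Q x = - x\<close>, against the bound
    \<open>small\<close>.\<close>
  have "inj P"
    unfolding linear_injective_0[OF linP]
  proof (intro allI impI, rule ccontr)
    fix x assume "P x = 0" "x \<noteq> 0"
    then have "norm (Q x) = norm x"
      by (metis P_def add_eq_0_iff norm_minus_cancel)
    then show False
      using small[OF \<open>x \<noteq> 0\<close>] by (simp add: Q_def)
  qed
  then obtain P' where linP': "linear P'" and PP': "\<And>x. P' (P x) = x" "\<And>x. P (P' x) = x"
    using linear_injective_isomorphism[OF linP] by blast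
  define J' where "J' x = P (J (P' x))" for x
  have acs': "almost_complex_structure J'"
    unfolding almost_complex_structure_def
  proof
    show "linear J'"
      using linear_compose[OF linP' linear_compose[OF _ linP], of J] acs
      by (simp add: J'_def[abs_def] o_def almost_complex_structure_def)
    show "\<forall>X. J' (J' X) = - X"
      by (simp add: J'_def PP' J_lin[OF acs] linear_neg[OF linP])
  qed
  have T: "(x, J x) + \<Phi> (x, J x) = (P x, J' (P x))" for x
  proof -
    \<comment> \<open>Multiplication by \<open>- \<i>\<close> sends \<open>(x, J x)\<close> to
      \<open>(J x, J (J x))\<close>, so complex linearity of \<open>\<Phi>\<close> says that
      \<open>Q\<close> anticommutes with \<open>J\<close>.\<close>
    have "J (Q x) = - Q (J x)"
      using Q\<Phi>[of "J x"] Q\<Phi>[of x] \<Phi>lin(2)[of "- \<i>" "(x, J x)"]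
      by (simp add: cscale_def J_lin[OF acs])
    then show ?thesis
      by (simp add: Q\<Phi> P_def J'_def PP'(1)[unfolded P_def])
  qed
  have "g01 J' = (\<lambda>Z. Z + \<Phi> Z) ` g01 J"
  proof
    show "(\<lambda>Z. Z + \<Phi> Z) ` g01 J \<subseteq> g01 J'"
    proof (clarsimp simp: g01_iff[OF acs])
      fix x show "(x, J x) + \<Phi> (x, J x) \<in> g01 J'"
        by (simp only: T) (simp add: g01_iff[OF acs'])
    qed
    show "g01 J' \<subseteq> (\<lambda>Z. Z + \<Phi> Z) ` g01 J"
    proof
      fix Z assume "Z \<in> g01 J'"
      then have "Z = (P (P' (fst Z)), J' (P (P' (fst Z))))"
        by (simp add: g01_iff[OF acs'] PP' prod_eq_iff)
      then have "Z = (P' (fst Z), J (P' (fst Z))) + \<Phi> (P' (fst Z), J (P' (fst Z)))"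
        unfolding T .
      then show "Z \<in> (\<lambda>Z. Z + \<Phi> Z) ` g01 J"
        by (intro image_eqI) (auto simp: g01_iff[OF acs])
    qed
  qed
  then show ?thesis
    using acs' by (auto simp: deformed_structure_def)
qed

lemma tensor01_cscale:
  fixes J :: "'a::euclidean_space \<Rightarrow> 'a"
  assumes "almost_complex_structure J" and "\<Phi> \<in> tensor01 J"
  shows "(\<lambda>Z. cscale c (\<Phi> Z)) \<in> tensor01 J"
proof -
  interpret vector_space "cscale :: complex \<Rightarrow> 'a cx \<Rightarrow> 'a cx"
    by (rule vector_space_cscale)
  have "cscale c V \<in> g10 J" if "V \<in> g10 J" for V
    using that by (simp add: g10_iff[OF assms(1)] cscale_simps J_lin[OF assms(1)])
  then show ?thesis
    using assms(2) unfolding tensor01_def linear_cscale2_iff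
    by (simp add: image_subset_iff scale_right_distrib mult.commute del: split_paired_All)
qed

lemma eventually_deformed_structure:
  fixes J :: "'a::euclidean_space \<Rightarrow> 'a"
  assumes acs: "almost_complex_structure J" and \<mu>: "\<mu> \<in> tensor01 J"
  shows "\<forall>\<^sub>F t in nhds 0. \<exists>J'. deformed_structure J (\<lambda>Z. cscale t (\<mu> Z)) J'"
proof -
  have lin: "\<mu> (Z + W) = \<mu> Z + \<mu> W" "\<mu> (cscale c Z) = cscale c (\<mu> Z)" for Z W c
    using \<mu> unfolding tensor01_def linear_cscale2_iff by blast+
  have "linear (\<lambda>x. \<mu> (x, 0))"
  proof (rule linearI)
    show "\<mu> (x + y, 0) = \<mu> (x, 0) + \<mu> (y, 0)" for x y
      using lin(1)[of "(x, 0)" "(y, 0)"] by simp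
    show "\<mu> (r *\<^sub>R x, 0) = r *\<^sub>R \<mu> (x, 0)" for r x
      using lin(2)[of "of_real r" "(x, 0)"] by (simp add: cscale_def prod_eq_iff)
  qed
  then obtain K where K: "K > 0" "\<And>x. norm (\<mu> (x, 0)) \<le> K * norm x"
    using linear_bounded_pos by blast
  \<comment> \<open>The 4 combines the 2 in the smallness condition with the two real terms that
    make up the first component of \<open>cscale t\<close>.\<close>
  have "\<forall>\<^sub>F t in nhds (0::complex). norm t < 1 / (4 * K)"
    using eventually_nhds_ball[of "1 / (4 * K)" "0::complex"] K(1) by (simp add: dist_norm)
  then show ?thesis
  proof eventually_elim
    fix t :: complex assume t: "norm t < 1 / (4 * K)"
    show "\<exists>J'. deformed_structure J (\<lambda>Z. cscale t (\<mu> Z)) J'"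
    proof (rule deformed_structure_exists[OF acs tensor01_cscale[OF acs \<mu>]])
      fix x :: 'a assume "x \<noteq> 0"
      let ?m = "\<mu> (x, 0)"
      have "norm (fst (cscale t ?m)) \<le> \<bar>Re t\<bar> * norm (fst ?m) + \<bar>Im t\<bar> * norm (snd ?m)"
        unfolding cscale_simps by (rule order_trans[OF norm_triangle_ineq4]) simp
      also have "\<dots> \<le> norm t * norm ?m + norm t * norm ?m"
        by (intro add_mono mult_mono abs_Re_le_cmod abs_Im_le_cmod norm_ge_zero)
          (metis norm_fst_le norm_snd_le prod.collapse)+
      also have "\<dots> \<le> 2 * norm t * (K * norm x)"
        using mult_left_mono[OF K(2)[of x], of "norm t"] by (simp add: ac_simps)
      finally have "norm (2 *\<^sub>R fst (cscale t ?m)) \<le> norm t * (4 * K) * norm x"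
        by (simp add: ac_simps)
      also have "\<dots> < 1 * norm x"
        using t K(1) \<open>x \<noteq> 0\<close> by (intro mult_strict_right_mono) (simp_all add: field_simps)
      finally show "norm (2 *\<^sub>R fst (cscale t ?m)) < norm x" by simp
    qed
  qed
qed

section \<open>The first-order term of an abelian deformation\<close>

text \<open>Evaluation at 0 removes the constant term. Dividing by \<open>t\<close> away from 0
  leaves a series with sum 0, and its limit at 0 is the coefficient in question.\<close>

lemma powser_zero_coeff_1:
  fixes a :: "nat \<Rightarrow> complex"
  assumes "\<forall>\<^sub>F t in nhds 0. (\<lambda>r. a r * t ^ r) sums 0"
  shows "a 1 = 0"
proof -
  obtain s where s: "s > 0" "\<And>t. norm t < s \<Longrightarrow> (\<lambda>r. a r * t ^ r) sums 0"
    using assms by (auto simp: eventually_nhds_metric)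
  have "a 0 = 0"
    using s(2)[of 0] s(1) by simp
  have "(\<lambda>r. a (Suc r) * t ^ r) sums 0" if "t \<noteq> 0" "norm t < s" for t
  proof -
    have "(\<lambda>r. a (Suc r) * t ^ Suc r) sums 0"
      using s(2)[OF that(2)] \<open>a 0 = 0\<close> by (subst sums_Suc_iff) simp
    from sums_mult[OF this, of "inverse t"] show ?thesis
      using that(1) by (simp add: field_simps)
  qed
  then have "((\<lambda>_. 0) \<longlongrightarrow> a (Suc 0)) (at (0::complex))"
    by (rule powser_limit_0_strong[OF s(1), of "\<lambda>r. a (Suc r)"])
  then show ?thesis
    by (simp add: tendsto_const_iff)
qed

text \<open>Ensures that the sum of a convergent series of \<open>(1,0)\<close>-vectors is again of
  type \<open>(1,0)\<close>.\<close>

lemma closed_g10: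
  fixes J :: "'a::euclidean_space \<Rightarrow> 'a"
  assumes "almost_complex_structure J"
  shows "closed (g10 J)"
proof -
  have "linear J" using assms by (simp add: almost_complex_structure_def)
  then have J: "continuous_on UNIV (\<lambda>Z :: 'a cx. J (fst Z))"
    by (intro linear_continuous_on_compose[where g = J] continuous_intros)
  have "g10 J = {Z. snd Z = - J (fst Z)}"
    using g10_iff[OF assms] by blast
  then show ?thesis
    by (simp add: closed_Collect_eq J continuous_intros)
qed

lemma deform_bracket_leading_coeff:
  fixes J :: "'a::euclidean_space \<Rightarrow> 'a"
  assumes bil: "bilinear br" and ab: "abelian_complex_structure br J"
    and def: "integrable_abelian_deformation br J \<mu>" and Z: "Z \<in> g01 J" and W: "W \<in> g01 J"
  shows "deform_bracket br \<mu> Z W = 0"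
proof -
  have acs: "almost_complex_structure J"
    using ab by (auto simp: abelian_complex_structure_def complex_structure_def)
  obtain \<phi> \<Phi> where \<phi>: "\<And>r. \<phi> r \<in> tensor01 J" "\<phi> 1 = \<mu>"
    and ev: "\<forall>\<^sub>F t in nhds 0. (\<forall>Z. (\<lambda>r. cscale (t ^ r) (\<phi> r Z)) sums \<Phi> t Z) \<and>
      (\<exists>J'. deformed_structure J (\<Phi> t) J' \<and> abelian_complex_structure br J')"
    using def unfolding integrable_abelian_deformation_def by blast
  \<comment> \<open>\<open>\<Phi> t\<close> is known only as a pointwise sum; its values lie in
    \<open>g10 J\<close> because the partial sums do.\<close>
  have zero: "deform_bracket br (\<Phi> t) Z W = 0"
    if sums: "\<And>Z. (\<lambda>r. cscale (t ^ r) (\<phi> r Z)) sums \<Phi> t Z"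
      and J': "deformed_structure J (\<Phi> t) J'" "abelian_complex_structure br J'" for t J'
  proof -
    have sub: "subspace (g10 J)"
      by (auto simp: subspace_def g10_iff[OF acs] J_lin[OF acs] linear_0 acs[unfolded almost_complex_structure_def])
    have "cscale (t ^ r) (\<phi> r V) \<in> g10 J" for r V
      using tensor01_cscale[OF acs \<phi>(1)] unfolding tensor01_def by blast
    then have "\<Phi> t V \<in> g10 J" for V
      by (intro closed_sequentially[OF closed_g10[OF acs] _ sums[unfolded sums_def]] subspace_sum[OF sub])
    then show ?thesis
      using deformed_abelian_iff[OF bil ab _ J'(1)] J'(2) Z W by blast
  qed
  have comp: "Complex (fst (deform_bracket br \<mu> Z W) \<bullet> b) (snd (deform_bracket br \<mu> Z W) \<bullet> b) = 0" for b
  proof -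
    \<comment> \<open>A complex coordinate of the complexification: it reduces the vector-valued
      series to scalar power series with coefficients \<open>a r\<close>.\<close>
    define e where "e V = Complex (fst V \<bullet> b) (snd V \<bullet> b)" for V :: "'a cx"
    have e: "e (V + V') = e V + e V'" "e (cscale c V) = c * e V" "e (r *\<^sub>R V) = r *\<^sub>R e V" "e 0 = 0" for V V' c r
      by (simp_all add: e_def cscale_def complex_eq_iff inner_simps)
    define a where "a r = e (deform_bracket br (\<phi> r) Z W)" for r
    have sc: "cbr br V (r *\<^sub>R V') = r *\<^sub>R cbr br V V'" "cbr br (r *\<^sub>R V) V' = r *\<^sub>R cbr br V V'" for r V V'
      using bil by (simp_all add: cbr_def prod_eq_iff bilinear_rmul bilinear_lmul algebra_simps)
    \<comment> \<open>Linear maps in finite dimension are bounded, hence can be applied term by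
      term.\<close>
    have l: "bounded_linear (\<lambda>V. e (cbr br Z V))" "bounded_linear (\<lambda>V. e (cbr br V W))"
      by (simp_all add: linear_conv_bounded_linear[symmetric] linear_iff cbr_add[OF bil] e sc)
    from ev have "\<forall>\<^sub>F t in nhds 0. (\<lambda>r. a r * t ^ r) sums 0"
    proof eventually_elim
      case (elim t)
      then have sums: "\<And>Z. (\<lambda>r. cscale (t ^ r) (\<phi> r Z)) sums \<Phi> t Z" by blast
      have "(\<lambda>r. e (cbr br Z (cscale (t ^ r) (\<phi> r W))) + e (cbr br (cscale (t ^ r) (\<phi> r Z)) W))
          sums (e (cbr br Z (\<Phi> t W)) + e (cbr br (\<Phi> t Z) W))"
        by (intro sums_add bounded_linear.sums[OF l(1)] bounded_linear.sums[OF l(2)] sums)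
      moreover have "e (cbr br Z (\<Phi> t W)) + e (cbr br (\<Phi> t Z) W) = 0"
        using zero[OF sums] elim e(4) by (auto simp: deform_bracket_def simp flip: e(1))
      ultimately show ?case
        by (simp add: a_def deform_bracket_def cbr_linear_right(2)[OF acs bil] cbr_linear_left[OF acs bil]
            e algebra_simps)
    qed
    then have "a 1 = 0"
      by (rule powser_zero_coeff_1)
    then show ?thesis
      unfolding a_def \<phi>(2) e_def .
  qed
  have "fst (deform_bracket br \<mu> Z W) \<bullet> b = 0" "snd (deform_bracket br \<mu> Z W) \<bullet> b = 0" for b
    using comp[of b] by (simp_all add: complex_eq_iff)
  then show ?thesis
    by (metis inner_eq_zero_iff prod_eq_iff fst_zero snd_zero)
qed

section \<open>The linear family as an abelian deformation\<close>

lemma integrable_abelian_deformationI: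
  fixes J :: "'a::euclidean_space \<Rightarrow> 'a"
  assumes bil: "bilinear br" and ab: "abelian_complex_structure br J" and \<mu>: "\<mu> \<in> tensor01 J"
    and zero: "\<And>Z W. Z \<in> g01 J \<Longrightarrow> W \<in> g01 J \<Longrightarrow> deform_bracket br \<mu> Z W = 0"
  shows "integrable_abelian_deformation br J \<mu>"
proof -
  have acs: "almost_complex_structure J"
    using ab by (auto simp: abelian_complex_structure_def complex_structure_def)
  \<comment> \<open>The series consists of \<open>t \<mu>\<close> alone: the condition is linear in
    the tensor, so no higher-order corrections arise.\<close>
  define \<phi> where "\<phi> r = (\<lambda>Z. if r = (1::nat) then \<mu> Z else 0)" for r
  have c0: "cscale c (0 :: 'a cx) = 0" for c
    by (simp add: cscale_def prod_eq_iff)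
  have \<phi>: "\<phi> r \<in> tensor01 J" for r
    using \<mu> tensor01_cscale[OF acs \<mu>, of 0] by (cases "r = 1") (simp_all add: \<phi>_def cscale_zero)
  have sums: "(\<lambda>r. cscale (t ^ r) (\<phi> r Z)) sums cscale t (\<mu> Z)" for t Z
  proof -
    have "(\<lambda>r. cscale (t ^ r) (\<phi> r Z)) = (\<lambda>r. if r = 1 then cscale (t ^ r) (\<mu> Z) else 0)"
      by (auto simp: \<phi>_def c0)
    then show ?thesis
      using sums_single[of 1 "\<lambda>r. cscale (t ^ r) (\<mu> Z)"] by simp
  qed
  have "\<forall>\<^sub>F t in nhds 0. (\<forall>Z. (\<lambda>r. cscale (t ^ r) (\<phi> r Z)) sums cscale t (\<mu> Z)) \<and>
      (\<exists>J'. deformed_structure J (\<lambda>Z. cscale t (\<mu> Z)) J' \<and> abelian_complex_structure br J')"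
    using eventually_deformed_structure[OF acs \<mu>]
  proof eventually_elim
    case (elim t)
    then obtain J' where J': "deformed_structure J (\<lambda>Z. cscale t (\<mu> Z)) J'" by blast
    have "deform_bracket br (\<lambda>Z. cscale t (\<mu> Z)) Z W = cscale t (deform_bracket br \<mu> Z W)" for Z W
      by (simp add: deform_bracket_def cbr_linear_right(2)[OF acs bil] cbr_linear_left[OF acs bil]
          vector_space.vector_space_assms(1)[OF vector_space_cscale])
    moreover have "cscale t (\<mu> Z) \<in> g10 J" for Z
      using tensor01_cscale[OF acs \<mu>] unfolding tensor01_def by blast
    ultimately have "abelian_complex_structure br J'"
      using deformed_abelian_iff[OF bil ab _ J'] by (simp add: zero c0)
    then show ?case
      using sums J' by blast
  qed
  moreover have "\<phi> 0 = (\<lambda>_. 0)" "\<phi> 1 = \<mu>"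
    by (auto simp: \<phi>_def)
  ultimately show ?thesis
    unfolding integrable_abelian_deformation_def
    using \<phi> by (intro exI[of _ \<phi>] exI[of _ "\<lambda>t Z. cscale t (\<mu> Z)"]) blast
qed


theorem proposition1:
  fixes G :: "('g::{t2_space, second_countable_topology}, 'm) monoid_scheme"
    and \<A> :: "('g set \<times> ('g \<Rightarrow> 'a::euclidean_space)) set"
    and \<Gamma> U :: "'g set"
    and \<phi> :: "'g \<Rightarrow> 'a"
    and J :: "'a \<Rightarrow> 'a"
    and h :: "'a \<Rightarrow> 'a \<Rightarrow> real"
    and \<mu> :: "'a cx \<Rightarrow> 'a cx"
  assumes "lie_group G \<A>"
    and "simply_connected (UNIV :: 'g set)"
    and "nilpotent_group G"
    and "subgroup \<Gamma> G" and "discrete \<Gamma>" and "cocompact G \<Gamma>"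
    and "(U, \<phi>) \<in> \<A>" and "\<one>\<^bsub>G\<^esub> \<in> U"
    and "abelian_complex_structure (lie_bracket G U \<phi>) J"
    and "hermitian_metric J h"
    and "harmonic (lie_bracket G U \<phi>) J h \<mu>"
  shows "integrable_abelian_deformation (lie_bracket G U \<phi>) J \<mu> \<longleftrightarrow>
           (\<forall>A B. dbar1 (lie_bracket G U \<phi>) J \<mu> A B = 0) \<and>
           (\<forall>\<omega>\<in>form01 J. \<forall>A B. sn_bracket (lie_bracket G U \<phi>) J \<mu> \<omega> A B = 0)"
proof -
  let ?br = "lie_bracket G U \<phi>"
  have bil: "bilinear ?br"
    using assms(1,7,8) by (rule lie_bracket_bilinear)
  have \<mu>: "\<mu> \<in> tensor01 J"
    using assms(11) by (simp add: harmonic_def)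
  \<comment> \<open>Vanishing of \<open>deform_bracket\<close> on \<open>g01 J\<close> is the common
    reformulation of both sides.\<close>
  have "integrable_abelian_deformation ?br J \<mu> \<longleftrightarrow>
      (\<forall>Z\<in>g01 J. \<forall>W\<in>g01 J. deform_bracket ?br \<mu> Z W = 0)"
    using deform_bracket_leading_coeff[OF bil assms(9)] integrable_abelian_deformationI[OF bil assms(9) \<mu>]
    by blast
  then show ?thesis
    using deform_bracket_zero_iff[OF bil lie_bracket_antisym assms(9) \<mu>] by simp
qed

end
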